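(* Let $d\ge 1$ be an integer and let $\mathcal{B}_d$ be the complete binary matroid on $\mathbb{F}_2^d$. Let $\mathcal{P}$ be any partition matroid with (possibly empty) parts $P_1,\dots,P_d$ that is a reduction of $\mathcal{B}_d$. Then there is a subset $T\subseteq[d]$ with $|T|\ge d-8\sqrt{d}$ and $\left|\bigcup_{i\in T}P_i\right|\le \frac{2^d}{\sqrt[4]{d}}$.
   Context: $[d]=\{1,\dots,d\}$. The complete binary matroid $\mathcal{B}_d$ has ground set $\mathbb{F}_2^d$ (all $2^d$ vectors, including $0$), and a set $S\subseteq\mathbb{F}_2^d$ is independent iff the vectors of $S$ are linearly independent over $\mathbb{F}_2$. A matroid $\mathcal{M}'=(E',\mathcal{I}')$ is a reduction of a matroid $\mathcal{M}=(E,\mathcal{I})$ if $E'\subseteq E$ and $\mathcal{I}'\subseteq\mathcal{I}$ (every independent set of $\mathcal{M}'$ is independent in $\mathcal{M}$). A partition matroid with parts $P_1,\dots,P_d$ has ground set the disjoint union $P_1\cup\dots\cup P_d$ (parts may be empty), and a set $S$ is independent iff $|S\cap P_i|\le 1$ for all $i$. *)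

theory Defs
  imports "HOL-Analysis.Cartesian_Space" "HOL-Library.Z2" "HOL-Library.Disjoint_Sets"
begin

type_synonym 'a set_system = "'a set \<times> 'a set set"

definition is_matroid :: "'a set_system \<Rightarrow> bool" where
  "is_matroid M \<longleftrightarrow> (case M of (E, \<I>) \<Rightarrow>
     finite E \<and> \<I> \<subseteq> Pow E \<and> {} \<in> \<I> \<and>
     (\<forall>A B. B \<in> \<I> \<and> A \<subseteq> B \<longrightarrow> A \<in> \<I>) \<and>
     (\<forall>A B. A \<in> \<I> \<and> B \<in> \<I> \<and> card A < card B \<longrightarrow> (\<exists>b\<in>B - A. insert b A \<in> \<I>)))"

definition is_reduction_of :: "'a set_system \<Rightarrow> 'a set_system \<Rightarrow> bool" where
  "is_reduction_of M' M \<longleftrightarrow> fst M' \<subseteq> fst M \<and> snd M' \<subseteq> snd M"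

text \<open>The field with two elements is the type \<^typ>\<open>bit\<close>, and \<open>d\<close> is the cardinality of
  the index type \<open>'n\<close>.\<close>

definition complete_binary_matroid :: "(bit ^ 'n) set_system" where
  "complete_binary_matroid = (UNIV, {S. vec.independent S})"

text \<open>The parts are \<open>P i\<close> for \<open>i \<in> I\<close>. They are meant to be pairwise disjoint, which is
  not enforced here: use together with \<^term>\<open>disjoint_family_on P I\<close>.
  Finiteness is explicit because the cardinality of an infinite set is \<open>0\<close>.\<close>

definition partition_matroid :: "'i set \<Rightarrow> ('i \<Rightarrow> 'a set) \<Rightarrow> 'a set_system" where
  "partition_matroid I P =
     (\<Union>i\<in>I. P i,
      {S. S \<subseteq> (\<Union>i\<in>I. P i) \<and> (\<forall>i\<in>I. finite (S \<inter> P i) \<and> card (S \<inter> P i) \<le> 1)})"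

lemma is_matroid_complete_binary_matroid:
  "is_matroid (complete_binary_matroid :: (bit ^ 'n) set_system)"
proof -
  have fin: "finite (X :: (bit ^ 'n) set)" for X
  proof -
    have "finite (UNIV :: bit set)"
      by (rule finite_subset[of _ "{0, 1}"]) (use bit_not_one_iff in auto)
    then have "finite (UNIV :: ('n \<Rightarrow> bit) set)"
      by (simp add: finite_UNIV_fun)
    then have "finite (range (vec_lambda :: ('n \<Rightarrow> bit) \<Rightarrow> bit ^ 'n))"
      by (rule finite_imageI)
    moreover have "range (vec_lambda :: ('n \<Rightarrow> bit) \<Rightarrow> bit ^ 'n) = UNIV"
      by (metis surjI vec_nth_inverse)
    ultimately show ?thesis
      by (metis finite_subset subset_UNIV)
  qed
  have exch: "\<exists>b\<in>B - A. vec.independent (insert b A)"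
    if "vec.independent A" "vec.independent B" "card A < card B" for A B :: "(bit ^ 'n) set"
  proof -
    have "\<not> B \<subseteq> vec.span A"
      using vec.independent_span_bound[OF fin that(2)] that(3) by (meson leD)
    then obtain b where "b \<in> B" "b \<notin> vec.span A" by blast
    then show ?thesis
      using that(1) vec.span_base vec.independent_insertI by blast
  qed
  show ?thesis
    unfolding is_matroid_def complete_binary_matroid_def prod.case mem_Collect_eq
  proof (intro conjI allI impI)
    show "vec.independent A" if "vec.independent B \<and> A \<subseteq> B" for A B :: "(bit ^ 'n) set"
      using that vec.independent_mono[of B A] by simp
    show "\<exists>b\<in>B - A. vec.independent (insert b A)"
      if "vec.independent A \<and> vec.independent B \<and> card A < card B" for A B :: "(bit ^ 'n) set"
      using that exch by simp
  qed (simp_all add: fin vec.independent_empty)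
qed

lemma is_matroid_partition_matroid:
  assumes "finite I" "disjoint_family_on P I" "finite (\<Union>i\<in>I. P i)"
  shows "is_matroid (partition_matroid I P)"
proof -
  let ?E = "\<Union>i\<in>I. P i"
  have card_eq: "card S = (\<Sum>i\<in>I. card (S \<inter> P i))" if "S \<subseteq> ?E" for S
  proof -
    have "card S = card (\<Union>i\<in>I. S \<inter> P i)"
      using that by (intro arg_cong[where f = card]) blast
    also have "\<dots> = (\<Sum>i\<in>I. card (S \<inter> P i))"
      using assms that by (intro card_UN_disjoint)
        (auto simp: disjoint_family_on_def dest: finite_subset)
    finally show ?thesis .
  qed
  have exch: "\<exists>b\<in>B - A. insert b A \<subseteq> ?E \<and> (\<forall>i\<in>I. card (insert b A \<inter> P i) \<le> 1)"
    if A: "A \<subseteq> ?E" "\<forall>i\<in>I. card (A \<inter> P i) \<le> 1" and B: "B \<subseteq> ?E" "\<forall>i\<in>I. card (B \<inter> P i) \<le> 1"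
      and less: "card A < card B" for A B
  proof -
    have fA: "finite A" and fB: "finite B"
      using A B assms(3) finite_subset by blast+
    have "\<exists>i\<in>I. card (A \<inter> P i) < card (B \<inter> P i)"
      using less card_eq[OF A(1)] card_eq[OF B(1)] sum_mono[of I "\<lambda>i. card (B \<inter> P i)" "\<lambda>i. card (A \<inter> P i)"]
      by (metis leD leI)
    then obtain i where i: "i \<in> I" "card (A \<inter> P i) < card (B \<inter> P i)" by blast
    then have "card (A \<inter> P i) = 0"
      using B(2) by (meson less_le_trans less_one)
    then have Ai: "A \<inter> P i = {}" using fA by simp
    obtain b where b: "b \<in> B" "b \<in> P i"
      using i(2) by (metis IntE card.empty equals0I less_nat_zero_code)
    have "card (insert b A \<inter> P j) \<le> 1" if "j \<in> I" for j
    proof (cases "j = i")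
      case True
      then have "insert b A \<inter> P j = {b}" using Ai b by auto
      then show ?thesis by simp
    next
      case False
      then have "b \<notin> P j"
        using b i(1) that assms(2) by (auto simp: disjoint_family_on_def)
      then show ?thesis using A(2) that by simp
    qed
    then show ?thesis using b Ai A(1) i(1) by (intro bexI[of _ b]) auto
  qed
  have fin: "finite (S \<inter> P i)" if "S \<subseteq> ?E" for S i
    using that assms(3) finite_subset by blast
  have mono: "card (A \<inter> P i) \<le> 1"
    if "A \<subseteq> B" "B \<subseteq> ?E" "card (B \<inter> P i) \<le> 1" for A B i
    using that fin[of B i] card_mono[of "B \<inter> P i" "A \<inter> P i"] by fastforce
  have eq: "partition_matroid I P = (?E, {S. S \<subseteq> ?E \<and> (\<forall>i\<in>I. card (S \<inter> P i) \<le> 1)})"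
    unfolding partition_matroid_def using fin by auto
  show ?thesis
    unfolding eq is_matroid_def prod.case
  proof (intro conjI allI impI)
    fix A B
    assume "B \<in> {S. S \<subseteq> ?E \<and> (\<forall>i\<in>I. card (S \<inter> P i) \<le> 1)} \<and> A \<subseteq> B"
    then show "A \<in> {S. S \<subseteq> ?E \<and> (\<forall>i\<in>I. card (S \<inter> P i) \<le> 1)}"
      using mono[of A B] by blast
  next
    fix A B
    assume "A \<in> {S. S \<subseteq> ?E \<and> (\<forall>i\<in>I. card (S \<inter> P i) \<le> 1)} \<and>
      B \<in> {S. S \<subseteq> ?E \<and> (\<forall>i\<in>I. card (S \<inter> P i) \<le> 1)} \<and> card A < card B"
    then show "\<exists>b\<in>B - A. insert b A \<in> {S. S \<subseteq> ?E \<and> (\<forall>i\<in>I. card (S \<inter> P i) \<le> 1)}"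
      using exch[of A B] by blast
  qed (use assms in auto)
qed

end

theory Submission imports Defs begin

text \<open>Independence of all transversals says that no sum of vectors from distinct parts vanishes.
  This property survives the following operation: choose a vector \<open>v\<close> in some part, drop that part,
  and replace every other part \<open>Q\<close> by \<open>Q \<union> (v + Q)\<close>. For \<open>x\<close> and \<open>y\<close> in different parts, \<open>x + y\<close>
  cannot lie in both of these parts, so on average over \<open>v\<close> the translates overlap the remaining
  parts in at most half of their size, and some \<open>v\<close> makes the total size grow by a factor of
  nearly \<open>3/2\<close>, while a single part at most doubles. Let \<open>T\<close> consist of the parts of size at most
  \<open>2^d / (8 \<surd>d)\<close>; at most \<open>8 \<surd>d\<close> parts are larger. If \<open>T\<close> covered more than
  \<open>2^d / d^(1/4)\<close> vectors, then iterating about \<open>log d\<close> times would yield disjoint sets of total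
  size more than \<open>2^d\<close>.\<close>

section \<open>Zero-sum-free families: disjointness, translates and their overlaps\<close>

text \<open>\<open>S\<close> ranges over all nonempty subsets of \<open>J\<close>, so the condition
  still bites when some parts are empty; singletons \<open>S\<close> keep 0 out of every
  part.\<close>

definition zero_sum_free :: "'i set \<Rightarrow> ('i \<Rightarrow> 'a::comm_monoid_add set) \<Rightarrow> bool" where
  "zero_sum_free J Q \<longleftrightarrow>
     (\<forall>S f. S \<subseteq> J \<and> S \<noteq> {} \<and> (\<forall>i\<in>S. f i \<in> Q i) \<longrightarrow> sum f S \<noteq> 0)"

lemma zero_sum_freeD:
  assumes "zero_sum_free J Q" "S \<subseteq> J" "S \<noteq> {}" "\<And>i. i \<in> S \<Longrightarrow> f i \<in> Q i"
  shows "sum f S \<noteq> 0"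
  using assms unfolding zero_sum_free_def by blast

text \<open>Disjointness comes for free, so the iteration has to carry only
  \<open>zero_sum_free\<close>.\<close>

lemma zero_sum_free_disjoint:
  fixes Q :: "'i \<Rightarrow> 'a::ab_group_add set"
  assumes "zero_sum_free J Q" and char2: "\<And>x::'a. x + x = 0"
    and "i \<in> J" "j \<in> J" "i \<noteq> j"
  shows "Q i \<inter> Q j = {}"
proof (rule ccontr)
  assume "Q i \<inter> Q j \<noteq> {}"
  then obtain x where "x \<in> Q i" "x \<in> Q j" by blast
  then have "(\<Sum>l\<in>{i, j}. x) \<noteq> 0"
    using assms by (intro zero_sum_freeD[where J = J and Q = Q]) auto
  then show False
    using \<open>i \<noteq> j\<close> char2 by simp
qed

text \<open>Undoing the translations turns a sum over \<open>S\<close> into a sum of original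
  vectors, possibly plus \<open>v\<close>. In the second case \<open>v\<close> serves as the choice
  from \<open>Q i\<close>, which is why part \<open>i\<close> must be dropped.\<close>

lemma zero_sum_free_translate:
  fixes Q :: "'i \<Rightarrow> 'a::ab_group_add set"
  assumes zsf: "zero_sum_free J Q" and "finite J" and char2: "\<And>x::'a. x + x = 0"
    and i: "i \<in> J" and v: "v \<in> Q i"
  shows "zero_sum_free (J - {i}) (\<lambda>j. Q j \<union> (+) v ` Q j)"
  unfolding zero_sum_free_def
proof (intro allI impI, elim conjE)
  fix S f
  assume S: "S \<subseteq> J - {i}" "S \<noteq> {}" and f: "\<forall>j\<in>S. f j \<in> Q j \<union> (+) v ` Q j"
  have "finite S"
    using S \<open>finite J\<close> finite_subset by blast
  define g where "g j = (if f j \<in> Q j then f j else v + f j)" for j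
  have vv: "v + (v + x) = x" for x
    by (metis add.assoc add_0 char2)
  have g: "g j \<in> Q j" if "j \<in> S" for j
    using f that by (auto simp: g_def vv)
  \<comment> \<open>Copies of \<open>v\<close> cancel in pairs, so only their parity
    survives.\<close>
  have split: "sum f S' = sum g S' \<or> sum f S' = v + sum g S'" if "finite S'" for S'
    using that
  proof induction
    case (insert j F)
    have "f j = g j \<or> f j = v + g j"
      by (simp add: g_def vv)
    then show ?case
      using insert by (auto simp: ac_simps vv)
  qed simp
  have "sum g S \<noteq> 0"
    using zsf S g by (intro zero_sum_freeD[where J = J and Q = Q]) auto
  moreover have "sum (g(i := v)) (insert i S) \<noteq> 0"
    using zsf S g i v by (intro zero_sum_freeD[where J = J and Q = Q]) auto
  moreover have "sum (g(i := v)) S = sum g S"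
    using S by (intro sum.cong) auto
  then have "sum (g(i := v)) (insert i S) = v + sum g S"
    using S \<open>finite S\<close> by (subst sum.insert) auto
  ultimately show "sum f S \<noteq> 0"
    using split[OF \<open>finite S\<close>] by auto
qed

lemma sum_card_le_card_UNIV:
  fixes Q :: "'i \<Rightarrow> 'a::ab_group_add set"
  assumes "zero_sum_free J Q" "finite J" "finite (UNIV :: 'a set)" "\<And>x::'a. x + x = 0"
  shows "(\<Sum>j\<in>J. card (Q j)) \<le> card (UNIV :: 'a set)"
proof -
  have "(\<Sum>j\<in>J. card (Q j)) = card (\<Union>j\<in>J. Q j)"
    using assms zero_sum_free_disjoint[OF assms(1,4)]
    by (subst card_UN_disjoint) (auto intro: finite_subset[OF subset_UNIV])
  also have "\<dots> \<le> card (UNIV :: 'a set)"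
    using assms by (intro card_mono) auto
  finally show ?thesis .
qed

text \<open>Each pair \<open>(x, y) \<in> A \<times> B\<close> is counted at most once on the left, since \<open>x + y\<close> cannot
  lie in both of the disjoint sets \<open>A\<close> and \<open>B\<close>.\<close>

lemma card_translate_overlaps_le:
  fixes A B :: "'a::ab_group_add set"
  assumes "finite A" "finite B" "A \<inter> B = {}" and char2: "\<And>x::'a. x + x = 0"
  shows "(\<Sum>x\<in>A. card (B \<inter> (+) x ` B)) + (\<Sum>y\<in>B. card (A \<inter> (+) y ` A)) \<le> card A * card B"
proof -
  have vv: "x + (x + y) = y" for x y :: 'a
    by (metis add.assoc add_0 char2)
  have overlap: "B \<inter> (+) x ` B = {y \<in> B. x + y \<in> B}" for x and B :: "'a set"
    by (force simp: image_iff vv)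
  have 1: "(\<Sum>x\<in>A. card (B \<inter> (+) x ` B)) = card {(x, y) \<in> A \<times> B. x + y \<in> B}"
  proof -
    have "{(x, y) \<in> A \<times> B. x + y \<in> B} = (SIGMA x:A. B \<inter> (+) x ` B)"
      by (auto simp: overlap)
    then show ?thesis using assms by simp
  qed
  have 2: "(\<Sum>y\<in>B. card (A \<inter> (+) y ` A)) = card {(x, y) \<in> A \<times> B. x + y \<in> A}"
  proof -
    have "{(x, y) \<in> A \<times> B. x + y \<in> A} = prod.swap ` (SIGMA y:B. A \<inter> (+) y ` A)"
      by (auto simp: overlap image_iff add.commute)
    then show ?thesis using assms by (simp add: card_image)
  qed
  have "(\<Sum>x\<in>A. card (B \<inter> (+) x ` B)) + (\<Sum>y\<in>B. card (A \<inter> (+) y ` A)) =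
      card ({(x, y) \<in> A \<times> B. x + y \<in> B} \<union> {(x, y) \<in> A \<times> B. x + y \<in> A})"
    unfolding 1 2 using assms
    by (intro card_Un_disjoint[symmetric]) (auto intro: finite_subset[of _ "A \<times> B"])
  also have "\<dots> \<le> card (A \<times> B)"
    using assms by (intro card_mono) auto
  finally show ?thesis
    by (simp add: card_cartesian_product)
qed

text \<open>Without overlaps the two sums would total \<open>4 * (card A * card B)\<close>; the
  overlaps cost at most one quarter of it.\<close>

lemma card_translate_unions_ge:
  fixes A B :: "'a::ab_group_add set"
  assumes "finite A" "finite B" "A \<inter> B = {}" and char2: "\<And>x::'a. x + x = 0"
  shows "3 * (card A * card B) \<le>
    (\<Sum>x\<in>A. card (B \<union> (+) x ` B)) + (\<Sum>y\<in>B. card (A \<union> (+) y ` A))"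
proof -
  have card: "card (B \<union> (+) x ` B) + card (B \<inter> (+) x ` B) = 2 * card B"
    if "finite B" for x and B :: "'a set"
    using that card_Un_Int[of B "(+) x ` B"] by (simp add: card_image)
  have "(\<Sum>x\<in>A. card (B \<union> (+) x ` B)) + (\<Sum>x\<in>A. card (B \<inter> (+) x ` B)) = 2 * (card A * card B)"
    and "(\<Sum>y\<in>B. card (A \<union> (+) y ` A)) + (\<Sum>y\<in>B. card (A \<inter> (+) y ` A)) = 2 * (card A * card B)"
    using assms by (simp_all add: card flip: sum.distrib)
  then show ?thesis
    using card_translate_overlaps_le[OF assms] by linarith
qed

section \<open>Growth of the total size\<close>

text \<open>Averaging over all vectors of all parts: the union bound for pairs gives a mean factor
  of 3/2, and \<open>c\<close> bounds the size of the dropped part.\<close>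

lemma zero_sum_free_growth_step:
  fixes Q :: "'i \<Rightarrow> 'a::ab_group_add set"
  assumes zsf: "zero_sum_free J Q" and J: "finite J" and fin: "finite (UNIV :: 'a set)"
    and char2: "\<And>x::'a. x + x = 0" and "0 \<le> c" and c: "\<And>j. j \<in> J \<Longrightarrow> real (card (Q j)) \<le> c"
  obtains J' and Q' :: "'i \<Rightarrow> 'a set" where "zero_sum_free J' Q'" "finite J'"
    "\<And>j. j \<in> J' \<Longrightarrow> real (card (Q' j)) \<le> 2 * c"
    "3 / 2 * ((\<Sum>j\<in>J. real (card (Q j))) - c) \<le> (\<Sum>j\<in>J'. real (card (Q' j)))"
proof -
  define q where "q j = real (card (Q j))" for j
  define N where "N = (\<Sum>j\<in>J. q j)"
  define F where "F i j = (\<Sum>x\<in>Q i. real (card (Q j \<union> (+) x ` Q j)))" for i j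
  have finQ: "finite A" for A :: "'a set"
    by (rule finite_subset[OF subset_UNIV fin])
  show thesis
  proof (cases "N \<le> c")
    \<comment> \<open>The required size is not positive here, so the empty family will do.\<close>
    case True
    then show thesis
      by (intro that[of "{}"]) (auto simp: zero_sum_free_def N_def q_def)
  next
    case False
    have pair: "3 * (q i * q j) \<le> F i j + F j i" if "i \<in> J" "j \<in> J" "i \<noteq> j" for i j
    proof -
      have "real (3 * (card (Q i) * card (Q j))) \<le>
          real ((\<Sum>x\<in>Q i. card (Q j \<union> (+) x ` Q j)) + (\<Sum>y\<in>Q j. card (Q i \<union> (+) y ` Q i)))"
        using card_translate_unions_ge[OF finQ finQ zero_sum_free_disjoint[OF zsf char2 that] char2]
        by (intro of_nat_mono)
      then show ?thesis by (simp add: F_def q_def)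
    qed
    \<comment> \<open>Total size of the new family, summed over all \<open>N\<close> choices of the
      translating vector.\<close>
    define E where "E = (\<Sum>i\<in>J. \<Sum>j\<in>J - {i}. F i j)"
    have swap: "(\<Sum>i\<in>J. \<Sum>j\<in>J - {i}. F j i) = E"
    proof -
      have "(\<Sum>i\<in>J. \<Sum>j\<in>J - {i}. F j i) = (\<Sum>j\<in>J. \<Sum>i\<in>J - {j}. F j i)"
      proof -
        have "J - {i} = {j \<in> J. j \<noteq> i}" "J - {i} = {j \<in> J. i \<noteq> j}" for i by auto
        then show ?thesis
          using sum.swap_restrict[OF J J, of "\<lambda>i j. F j i" "\<lambda>i j. i \<noteq> j"] by simp
      qed
      then show ?thesis by (simp add: E_def)
    qed
    \<comment> \<open>Since \<open>q i \<le> c\<close>, the other parts hold at least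
      \<open>N - c\<close> vectors. Each \<open>F i j\<close> with \<open>i \<noteq> j\<close>
      occurs twice in the symmetrised sum, hence \<open>2 * E\<close>.\<close>
    have "3 * (N * (N - c)) \<le> 3 * (\<Sum>i\<in>J. q i * (N - q i))"
      unfolding N_def sum_distrib_right[of _ J]
      by (intro mult_left_mono sum_mono) (use c in \<open>auto simp: q_def\<close>)
    also have "\<dots> = (\<Sum>i\<in>J. \<Sum>j\<in>J - {i}. 3 * (q i * q j))"
      using J by (simp add: N_def sum_diff1 sum_distrib_left right_diff_distrib)
    also have "\<dots> \<le> (\<Sum>i\<in>J. \<Sum>j\<in>J - {i}. F i j + F j i)"
      using pair by (intro sum_mono) auto
    also have "\<dots> = 2 * E"
      using swap by (simp add: sum.distrib E_def)
    finally have E: "3 / 2 * (N - c) * N \<le> E"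
      by (simp add: mult_ac)
    have "\<exists>i\<in>J. \<exists>x\<in>Q i. 3 / 2 * (N - c) \<le> (\<Sum>j\<in>J - {i}. real (card (Q j \<union> (+) x ` Q j)))"
    proof (rule ccontr)
      assume neg: "\<not> ?thesis"
      \<comment> \<open>If each of the \<open>N\<close> choices fell short, \<open>E\<close> would
        be below \<open>3 / 2 * (N - c) * N\<close>; strictness needs at least one choice, which
        \<open>N > c \<ge> 0\<close> provides.\<close>
      have const: "(\<Sum>i\<in>J. \<Sum>x\<in>Q i. b) = b * N" for b
        by (simp add: N_def q_def mult.commute sum_distrib_left)
      have "(SIGMA i:J. Q i) \<noteq> {}"
      proof
        assume "(SIGMA i:J. Q i) = {}"
        then have "Q i = {}" if "i \<in> J" for i
          using that by blast
        then show False
          using False \<open>0 \<le> c\<close> by (simp add: N_def q_def)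
      qed
      have "E = (\<Sum>i\<in>J. \<Sum>x\<in>Q i. \<Sum>j\<in>J - {i}. real (card (Q j \<union> (+) x ` Q j)))"
        unfolding E_def F_def by (intro sum.cong refl sum.swap)
      also have "\<dots> = (\<Sum>(i, x)\<in>(SIGMA i:J. Q i). \<Sum>j\<in>J - {i}. real (card (Q j \<union> (+) x ` Q j)))"
        using J finQ by (intro sum.Sigma) auto
      also have "\<dots> < (\<Sum>(i, x)\<in>(SIGMA i:J. Q i). 3 / 2 * (N - c))"
        using neg J finQ \<open>(SIGMA i:J. Q i) \<noteq> {}\<close> by (intro sum_strict_mono) (auto simp: not_le)
      also have "\<dots> = (\<Sum>i\<in>J. \<Sum>x\<in>Q i. 3 / 2 * (N - c))"
        using J finQ by (intro sum.Sigma[symmetric]) auto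
      also have "\<dots> = 3 / 2 * (N - c) * N"
        by (rule const)
      finally show False using E by simp
    qed
    then obtain i x where i: "i \<in> J" and x: "x \<in> Q i"
      and ge: "3 / 2 * (N - c) \<le> (\<Sum>j\<in>J - {i}. real (card (Q j \<union> (+) x ` Q j)))"
      by blast
    show thesis
    proof (rule that)
      show "zero_sum_free (J - {i}) (\<lambda>j. Q j \<union> (+) x ` Q j)"
        by (rule zero_sum_free_translate[OF zsf J char2 i x])
      show "real (card (Q j \<union> (+) x ` Q j)) \<le> 2 * c" if "j \<in> J - {i}" for j
      proof -
        have "card (Q j \<union> (+) x ` Q j) \<le> card (Q j) + card (Q j)"
          using card_Un_le[of "Q j" "(+) x ` Q j"] by (simp add: card_image)
        then show ?thesis using c[of j] that by simp
      qed
      show "3 / 2 * ((\<Sum>j\<in>J. real (card (Q j))) - c)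
          \<le> (\<Sum>j\<in>J - {i}. real (card (Q j \<union> (+) x ` Q j)))"
        using ge by (simp add: N_def q_def)
    qed (use J in simp)
  qed
qed

text \<open>Step \<open>j\<close> sends a total \<open>N\<close> to at least
  \<open>3 / 2 * (N - 2 ^ j * c)\<close>. Divided by the powers of 3/2, the losses are
  \<open>c * (4 / 3) ^ j\<close>, and their sum over \<open>j < k\<close> is
  \<open>3 * c * ((4 / 3) ^ k - 1)\<close>. The final parts are disjoint, hence the upper
  bound.\<close>

lemma zero_sum_free_growth:
  fixes Q :: "'i \<Rightarrow> 'a::ab_group_add set"
  assumes zsf: "zero_sum_free J Q" and J: "finite J" and fin: "finite (UNIV :: 'a set)"
    and char2: "\<And>x::'a. x + x = 0" and "0 \<le> c" and c: "\<And>j. j \<in> J \<Longrightarrow> real (card (Q j)) \<le> c"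
  shows "(3 / 2) ^ k * ((\<Sum>j\<in>J. real (card (Q j))) - 3 * c * ((4 / 3) ^ k - 1))
    \<le> real (card (UNIV :: 'a set))"
proof -
  let ?N = "\<Sum>j\<in>J. real (card (Q j))"
  have "\<exists>J' (Q' :: 'i \<Rightarrow> 'a set). zero_sum_free J' Q' \<and> finite J' \<and>
      (\<forall>j\<in>J'. real (card (Q' j)) \<le> 2 ^ k * c) \<and>
      (3 / 2) ^ k * (?N - 3 * c * ((4 / 3) ^ k - 1)) \<le> (\<Sum>j\<in>J'. real (card (Q' j)))"
  proof (induction k)
    case 0
    then show ?case
      using zsf J c by (intro exI[of _ J] exI[of _ Q]) simp
  next
    case (Suc k)
    then obtain J1 and Q1 :: "'i \<Rightarrow> 'a set" where 1: "zero_sum_free J1 Q1" "finite J1"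
      "\<And>j. j \<in> J1 \<Longrightarrow> real (card (Q1 j)) \<le> 2 ^ k * c"
      "(3 / 2) ^ k * (?N - 3 * c * ((4 / 3) ^ k - 1)) \<le> (\<Sum>j\<in>J1. real (card (Q1 j)))"
      by blast
    obtain J2 and Q2 :: "'i \<Rightarrow> 'a set" where 2: "zero_sum_free J2 Q2" "finite J2"
      "\<And>j. j \<in> J2 \<Longrightarrow> real (card (Q2 j)) \<le> 2 * (2 ^ k * c)"
      "3 / 2 * ((\<Sum>j\<in>J1. real (card (Q1 j))) - 2 ^ k * c) \<le> (\<Sum>j\<in>J2. real (card (Q2 j)))"
      using zero_sum_free_growth_step[OF 1(1,2) fin char2 _ 1(3)] \<open>0 \<le> c\<close> by auto
    have "(2::real) ^ k = (3 / 2) ^ k * (4 / 3) ^ k"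
      by (simp flip: power_mult_distrib)
    then have "(3 / 2) ^ Suc k * (?N - 3 * c * ((4 / 3) ^ Suc k - 1)) =
        3 / 2 * ((3 / 2) ^ k * (?N - 3 * c * ((4 / 3) ^ k - 1)) - 2 ^ k * c)"
      by (simp add: algebra_simps)
    also have "\<dots> \<le> 3 / 2 * ((\<Sum>j\<in>J1. real (card (Q1 j))) - 2 ^ k * c)"
      using 1(4) by simp
    also note 2(4)
    finally show ?case
      using 2 by (intro exI[of _ J2] exI[of _ Q2]) (simp add: mult.assoc)
  qed
  then obtain J' and Q' :: "'i \<Rightarrow> 'a set" where "zero_sum_free J' Q'" "finite J'"
    and le: "(3 / 2) ^ k * (?N - 3 * c * ((4 / 3) ^ k - 1)) \<le> (\<Sum>j\<in>J'. real (card (Q' j)))"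
    by blast
  then have "(\<Sum>j\<in>J'. card (Q' j)) \<le> card (UNIV :: 'a set)"
    using sum_card_le_card_UNIV fin char2 by blast
  then have "(\<Sum>j\<in>J'. real (card (Q' j))) \<le> real (card (UNIV :: 'a set))"
    by (metis of_nat_le_iff of_nat_sum)
  then show ?thesis using le by linarith
qed

section \<open>Choice of the number of iterations\<close>

text \<open>Makes the loss linear in \<open>s = (3 / 2) ^ k\<close>, so that choosing
  \<open>k\<close> becomes a quadratic problem in \<open>s\<close>.\<close>

lemma power_four_thirds_le: "(4 / 3 :: real) ^ k \<le> 2 + (3 / 2) ^ k / 3"
proof (cases "k < 7")
  case True
  then have "k \<in> {0, 1, 2, 3, 4, 5, 6}" by auto
  then show ?thesis by (auto simp: power_divide)
next
  case False
  then have "7 \<le> k" by simp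
  then show ?thesis
  proof (induction k rule: dec_induct)
    case base
    then show ?case by (simp add: power_divide)
  next
    case (step n)
    \<comment> \<open>The induction step amounts to \<open>(3 / 2) ^ n \<ge> 12\<close>, and 7 is
      the first exponent to satisfy this.\<close>
    have "(3 / 2 :: real) ^ 7 \<le> (3 / 2) ^ n"
      using step by (intro power_increasing) auto
    moreover have "12 \<le> (3 / 2 :: real) ^ 7"
      by (simp add: power_divide)
    ultimately have "12 \<le> (3 / 2 :: real) ^ n"
      by linarith
    then show ?case using step by simp
  qed
qed

text \<open>This is the growth bound for total size \<open>U / D\<close> and
  \<open>c = U / (8 * D\<^sup>2)\<close>, scaled by \<open>D\<^sup>2 / U\<close>, where
  \<open>U\<close> is the size of the whole space.\<close>

lemma growth_exponent_exists:
  assumes "D \<ge> (2::real)"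
  obtains k :: nat where "D * D \<le> (3 / 2) ^ k * (D - 3 / 8 * ((4 / 3) ^ k - 1))"
proof -
  define k where "k = (LEAST k. 2 * D \<le> (3 / 2) ^ k)"
  define s :: real where "s = (3 / 2) ^ k"
  have "\<exists>k. 2 * D < (3 / 2) ^ k"
    by (rule real_arch_pow) simp
  then have "\<exists>k. 2 * D \<le> (3 / 2) ^ k"
    using less_imp_le by blast
  then have s2: "2 * D \<le> s"
    unfolding s_def k_def by (rule LeastI_ex)
  have "k \<noteq> 0"
    using s2 assms by (auto simp: s_def intro!: gr0I)
  then obtain k' where k': "k = Suc k'"
    using not0_implies_Suc by blast
  then have "\<not> 2 * D \<le> (3 / 2) ^ k'"
    unfolding k_def by (metis lessI not_less_Least)
  then have s3: "s \<le> 3 * D"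
    by (simp add: s_def k')
  \<comment> \<open>As \<open>k\<close> is least, \<open>s\<close> lies between \<open>2 * D\<close>
    and \<open>3 * D\<close>. This product then bounds \<open>s * s\<close> by
    \<open>5 * (D * s) - 6 * (D * D)\<close>.\<close>
  have "0 \<le> (s - 2 * D) * (3 * D - s)"
    using s2 s3 by simp
  moreover have "(s - 2 * D) * (3 * D - s) = 5 * (D * s) - s * s - 6 * (D * D)"
    by (simp add: algebra_simps)
  moreover have "2 * s \<le> D * s" "(2 * D) * D \<le> s * D" "0 \<le> D * s"
    using assms s2 by (auto intro: mult_right_mono)
  moreover have "s * (D - 3 / 8 * (1 + s / 3)) = D * s - 3 / 8 * s - s * s / 8"
    by (simp add: algebra_simps)
  ultimately have "D * D \<le> s * (D - 3 / 8 * (1 + s / 3))"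
    by (simp add: mult.commute[of s D])
  also have "\<dots> \<le> s * (D - 3 / 8 * ((4 / 3) ^ k - 1))"
    using power_four_thirds_le[of k] by (intro mult_left_mono) (auto simp: s_def)
  finally show thesis
    using that by (simp add: s_def)
qed

lemma zero_sum_free_small_parts:
  fixes Q :: "'i \<Rightarrow> 'a::ab_group_add set"
  assumes "zero_sum_free J Q" "finite J" "finite (UNIV :: 'a set)" "\<And>x::'a. x + x = 0"
    and D: "D \<ge> 2" and c: "\<And>j. j \<in> J \<Longrightarrow> real (card (Q j)) \<le> card (UNIV :: 'a set) / (8 * D\<^sup>2)"
  shows "(\<Sum>j\<in>J. real (card (Q j))) \<le> card (UNIV :: 'a set) / D"
proof (rule ccontr)
  let ?U = "real (card (UNIV :: 'a set))" and ?N = "\<Sum>j\<in>J. real (card (Q j))"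
  assume "\<not> ?thesis"
  then have N: "?U / D < ?N" by simp
  obtain k :: nat where k: "D * D \<le> (3 / 2) ^ k * (D - 3 / 8 * ((4 / 3) ^ k - 1))"
    using growth_exponent_exists[OF D] .
  \<comment> \<open>Total size \<open>?U / D\<close> would already grow to \<open>?U\<close>; the
    strictly larger \<open>?N\<close> overshoots the space.\<close>
  have "?U = ?U / D\<^sup>2 * (D * D)"
    using D by (simp add: power2_eq_square)
  also have "\<dots> \<le> ?U / D\<^sup>2 * ((3 / 2) ^ k * (D - 3 / 8 * ((4 / 3) ^ k - 1)))"
    using k by (intro mult_left_mono) auto
  also have "\<dots> = (3 / 2) ^ k * (?U / D - 3 * (?U / (8 * D\<^sup>2)) * ((4 / 3) ^ k - 1))"
    using D by (simp add: field_simps power2_eq_square)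
  also have "\<dots> < (3 / 2) ^ k * (?N - 3 * (?U / (8 * D\<^sup>2)) * ((4 / 3) ^ k - 1))"
    using N by simp
  also have "\<dots> \<le> ?U"
    by (rule zero_sum_free_growth[OF assms(1-4) _ c]) simp
  finally show False by simp
qed

section \<open>Application to the binary matroid\<close>

lemma CARD_bit: "CARD(bit) = 2"
proof -
  have UNIV_bit: "(UNIV :: bit set) = {0, 1}"
    using bit_not_one_iff by auto
  show ?thesis by (simp add: UNIV_bit)
qed

lemma bit_vec_add_self: "x + x = (0 :: bit ^ 'n)"
  by (simp add: vec_eq_iff)

lemma finite_UNIV_bit_vec: "finite (UNIV :: (bit ^ 'n) set)"
  using is_matroid_complete_binary_matroid[where 'n = 'n]
  by (simp add: is_matroid_def complete_binary_matroid_def)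

lemma zero_sum_free_if_reduction:
  fixes P :: "'i \<Rightarrow> (bit ^ 'n) set"
  assumes "finite I" and disj: "disjoint_family_on P I"
    and red: "is_reduction_of (partition_matroid I P) complete_binary_matroid"
  shows "zero_sum_free I P"
  unfolding zero_sum_free_def
proof (intro allI impI, elim conjE)
  fix S f
  assume S: "S \<subseteq> I" "S \<noteq> {}" and f: "\<forall>i\<in>S. f i \<in> P i"
  have finS: "finite S"
    using S \<open>finite I\<close> finite_subset by blast
  have uniq: "i = j" if "i \<in> S" "j \<in> I" "f i \<in> P j" for i j
    using that f S disj unfolding disjoint_family_on_def by blast
  then have inj: "inj_on f S"
    using f S by (metis inj_onI subsetD)
  have "card (f ` S \<inter> P i) \<le> 1" if "i \<in> I" for i
  proof -
    have "f ` S \<inter> P i \<subseteq> {f i}"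
      using uniq that by auto
    from card_mono[OF _ this] show ?thesis by simp
  qed
  then have "f ` S \<in> snd (partition_matroid I P)"
    using S f finS by (auto simp: partition_matroid_def)
  then have "vec.independent (f ` S)"
    using red by (auto simp: is_reduction_of_def complete_binary_matroid_def)
  \<comment> \<open>Over the two-element field, a vanishing sum is a dependence with all
    coefficients 1.\<close>
  then have "(\<Sum>v\<in>f ` S. 1 *s v) \<noteq> 0"
    using S finS vec.independentD[of "f ` S" "f ` S" "\<lambda>_. 1"] by fastforce
  then show "sum f S \<noteq> 0"
    by (simp add: sum.reindex[OF inj])
qed

theorem mainTheorem1:
  fixes d :: nat and P :: "nat \<Rightarrow> (bit ^ 'n) set"
  assumes "d = CARD('n)"
    and "disjoint_family_on P {1..d}"
    and "is_reduction_of (partition_matroid {1..d} P) complete_binary_matroid"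
  shows "\<exists>T \<subseteq> {1..d}. real (card T) \<ge> real d - 8 * sqrt (real d) \<and>
           real (card (\<Union>i\<in>T. P i)) \<le> 2 ^ d / root 4 (real d)"
proof (cases "d < 16")
  case True
  \<comment> \<open>Here \<open>d \<le> 8 * sqrt d\<close>, so \<open>T = {}\<close> suffices. The
    other case gives \<open>D \<ge> 2\<close>.\<close>
  have "sqrt (real d) \<le> 4"
    using True by (intro real_le_lsqrt) auto
  then have "sqrt (real d) * sqrt (real d) \<le> 8 * sqrt (real d)"
    by (intro mult_right_mono) auto
  then show ?thesis
    by (intro exI[of _ "{}"]) auto
next
  case False
  define D where "D = root 4 (real d)"
  have D4: "D ^ 4 = real d"
    by (simp add: D_def)
  have "root 4 (2 ^ 4) \<le> D"
    unfolding D_def using False by (intro real_root_le_mono) auto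
  then have D2: "D \<ge> 2"
    by (subst (asm) real_root_power_cancel) auto
  have "(D\<^sup>2)\<^sup>2 = real d"
    using D4 by (simp flip: power_mult)
  then have sqrt: "sqrt (real d) = D\<^sup>2"
    by (metis real_sqrt_unique zero_le_power2)
  have zsf: "zero_sum_free {1..d} P"
    using assms by (intro zero_sum_free_if_reduction) auto
  define T where "T = {j \<in> {1..d}. real (card (P j)) \<le> 2 ^ d / (8 * D\<^sup>2)}"
  have T: "T \<subseteq> {1..d}"
    by (auto simp: T_def)
  have zsfT: "zero_sum_free T P"
    using zsf unfolding zero_sum_free_def T_def by blast
  \<comment> \<open>Parts outside \<open>T\<close> exceed \<open>2 ^ d / (8 * D\<^sup>2)\<close> and
    are disjoint, so there are at most \<open>8 * D\<^sup>2\<close>, that is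
    \<open>8 * sqrt d\<close>, of them.\<close>
  have "card ({1..d} - T) * (2 ^ d / (8 * D\<^sup>2)) \<le> (\<Sum>j\<in>{1..d} - T. real (card (P j)))"
    by (rule sum_bounded_below) (auto simp: T_def)
  also have "\<dots> \<le> (\<Sum>j\<in>{1..d}. real (card (P j)))"
    by (rule sum_mono2) auto
  also have "\<dots> = real (\<Sum>j\<in>{1..d}. card (P j))"
    by simp
  also have "\<dots> \<le> real (2 ^ d)"
    using sum_card_le_card_UNIV[OF zsf _ finite_UNIV_bit_vec bit_vec_add_self] assms(1)
    by (intro of_nat_mono) (simp add: CARD_bit)
  finally have "real (card ({1..d} - T)) \<le> 8 * D\<^sup>2"
    using D2 by (simp add: field_simps)
  moreover have "card ({1..d} - T) = d - card T" "card T \<le> d"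
    using card_Diff_subset[OF finite_subset[OF T]] card_mono[OF _ T] T by auto
  ultimately have cardT: "real (card T) \<ge> real d - 8 * sqrt (real d)"
    by (simp add: sqrt of_nat_diff)
  have "real (card (\<Union>i\<in>T. P i)) \<le> (\<Sum>j\<in>T. real (card (P j)))"
    using card_UN_le[of T P] by (simp add: T_def flip: of_nat_sum)
  also have "\<dots> \<le> card (UNIV :: (bit ^ 'n) set) / D"
    by (rule zero_sum_free_small_parts[OF zsfT _ finite_UNIV_bit_vec bit_vec_add_self D2]) (auto simp: T_def CARD_bit assms(1))
  finally have "real (card (\<Union>i\<in>T. P i)) \<le> 2 ^ d / root 4 (real d)"
    by (simp add: CARD_bit assms(1) D_def)
  with cardT show ?thesis
    using T by blast
qed

end
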